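(* Consider the following statements. (i) $\mathbf{0}\in\operatorname{int}\operatorname{hull}\mathcal{D}$. (ii) $\mathbb{P}(r_\infty=\infty)=1$. (iii) $\mathbb{P}(\mathcal{H}_\infty=\mathbb{R}^d)=1$. (iv) $\mathcal{D}_\pm=\mathbb{S}^{d-1}$. (v) $\mathbf{0}\in\operatorname{hull}\mathcal{D}$. Then the following implications hold: (i) $\Rightarrow$ (ii) $\Leftrightarrow$ (iii) $\Leftrightarrow$ (iv) $\Rightarrow$ (v).
   Context: Let $d\in\mathbb{N}=\{1,2,3,\ldots\}$. Let $X,X_1,X_2,\ldots$ be i.i.d. random variables in $\mathbb{R}^d$, and let $S_0=\mathbf{0}$, $S_n=\sum_{k=1}^n X_k$ for $n\ge 1$, be the associated random walk. Standing assumption: the walk is genuinely $d$-dimensional, i.e. $\operatorname{supp}X$ is not contained in a $(d-1)$-dimensional (linear) subspace of $\mathbb{R}^d$. Here $\|\cdot\|$ is the Euclidean norm, $\mathbb{S}^{d-1}=\{\mathbf{x}\in\mathbb{R}^d:\|\mathbf{x}\|=1\}$, $\hat{\mathbf{x}}=\mathbf{x}/\|\mathbf{x}\|$ for $\mathbf{x}\neq\mathbf{0}$, and $\hat{\mathbf{0}}=\mathbf{0}$; write $\hat S_n$ for the image of $S_n$ under this map. $\operatorname{hull}A$ is the convex hull of $A\subseteq\mathbb{R}^d$, and $\operatorname{int}$ denotes interior in $\mathbb{R}^d$. Define - $\mathcal{D}=\{\mathbf{u}\in\mathbb{S}^{d-1}:\liminf_{n\to\infty}\|\hat S_n-\mathbf{u}\|=0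 \text{ almost surely}\}$; - $\mathcal{D}_\pm=\{\mathbf{u}\in\mathbb{S}^{d-1}:-\infty=\liminf_{n\to\infty}(S_n\cdot\mathbf{u})<\limsup_{n\to\infty}(S_n\cdot\mathbf{u})=+\infty\text{ almost surely}\}$; - $\mathcal{H}_n=\operatorname{hull}\{S_0,S_1,\ldots,S_n\}$ and $\mathcal{H}_\infty=\bigcup_{n\ge0}\mathcal{H}_n$; - $r_n=\inf\{\|\mathbf{x}\|:\mathbf{x}\in\mathbb{R}^d\setminus\mathcal{H}_n\}$ and $r_\infty=\lim_{n\to\infty}r_n\in[0,\infty]$ (the limit exists since $r_n$ is non-decreasing). *)

theory Defs
  imports "HOL-Probability.Probability"
begin

text \<open>
  The space of dimension \<open>d\<close> is \<^typ>\<open>real ^ 'd\<close> with \<open>d = CARD('d)\<close>. The normalisation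
  of \<open>x\<close> to \<open>x / norm x\<close>, with \<open>0\<close> sent to \<open>0\<close>, is the library function \<^const>\<open>sgn\<close>
  (see \<open>sgn_div_norm\<close>).
\<close>

text \<open>The topological support of the law of \<open>Z\<close>.\<close>

definition rv_support :: "'w measure \<Rightarrow> ('w \<Rightarrow> real ^ 'd) \<Rightarrow> (real ^ 'd) set" where
  "rv_support M Z = {x. \<forall>U. open U \<and> x \<in> U \<longrightarrow> measure (distr M borel Z) U > 0}"

text \<open>Only the increments with index at least \<open>1\<close> are used; \<open>X 0\<close> plays no role.\<close>

definition walk :: "(nat \<Rightarrow> 'w \<Rightarrow> real ^ 'd) \<Rightarrow> nat \<Rightarrow> 'w \<Rightarrow> real ^ 'd" where
  "walk X n \<omega> = (\<Sum>k=1..n. X k \<omega>)"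

definition limit_directions :: "'w measure \<Rightarrow> (nat \<Rightarrow> 'w \<Rightarrow> real ^ 'd) \<Rightarrow> (real ^ 'd) set" where
  "limit_directions M X =
     {u \<in> sphere 0 1. AE \<omega> in M. liminf (\<lambda>n. ereal (norm (sgn (walk X n \<omega>) - u))) = 0}"

definition oscillation_directions :: "'w measure \<Rightarrow> (nat \<Rightarrow> 'w \<Rightarrow> real ^ 'd) \<Rightarrow> (real ^ 'd) set" where
  "oscillation_directions M X =
     {u \<in> sphere 0 1. AE \<omega> in M.
        liminf (\<lambda>n. ereal (walk X n \<omega> \<bullet> u)) = -\<infinity> \<and>
        limsup (\<lambda>n. ereal (walk X n \<omega> \<bullet> u)) = \<infinity>}"

definition walk_hull :: "(nat \<Rightarrow> 'w \<Rightarrow> real ^ 'd) \<Rightarrow> nat \<Rightarrow> 'w \<Rightarrow> (real ^ 'd) set" where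
  "walk_hull X n \<omega> = convex hull ((\<lambda>k. walk X k \<omega>) ` {0..n})"

definition walk_hull_inf :: "(nat \<Rightarrow> 'w \<Rightarrow> real ^ 'd) \<Rightarrow> 'w \<Rightarrow> (real ^ 'd) set" where
  "walk_hull_inf X \<omega> = (\<Union>n. walk_hull X n \<omega>)"

definition hull_inradius :: "(nat \<Rightarrow> 'w \<Rightarrow> real ^ 'd) \<Rightarrow> nat \<Rightarrow> 'w \<Rightarrow> ereal" where
  "hull_inradius X n \<omega> = (INF x \<in> UNIV - walk_hull X n \<omega>. ereal (norm x))"

definition hull_inradius_inf :: "(nat \<Rightarrow> 'w \<Rightarrow> real ^ 'd) \<Rightarrow> 'w \<Rightarrow> ereal" where
  "hull_inradius_inf X \<omega> = lim (\<lambda>n. hull_inradius X n \<omega>)"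

lemma incseq_hull_inradius: "incseq (\<lambda>n. hull_inradius X n \<omega>)"
proof (rule monoI)
  fix m n :: nat assume "m \<le> n"
  then have "walk_hull X m \<omega> \<subseteq> walk_hull X n \<omega>"
    unfolding walk_hull_def by (intro hull_mono image_mono) auto
  then show "hull_inradius X m \<omega> \<le> hull_inradius X n \<omega>"
    unfolding hull_inradius_def by (intro INF_superset_mono) auto
qed

lemma hull_inradius_tendsto:
  "(\<lambda>n. hull_inradius X n \<omega>) \<longlonglongrightarrow> hull_inradius_inf X \<omega>"
proof -
  have "(\<lambda>n. hull_inradius X n \<omega>) \<longlonglongrightarrow> (SUP n. hull_inradius X n \<omega>)"
    by (rule LIMSEQ_SUP[OF incseq_hull_inradius])
  then show ?thesis
    unfolding hull_inradius_inf_def by (simp add: limI)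
qed

end

theory Submission
  imports Defs
begin

text \<open>
  Filling space and oscillating in every direction are both statements about the barrier cone
  \<open>C\<close> of the random path, the set of directions \<open>u\<close> in which
  \<open>S\<^sub>n \<bullet> u\<close> is bounded above.

  The hull of a path is the whole space if and only if \<open>C\<close> contains no nonzero vector
  (\<open>convex_hull_range_eq_UNIV_iff\<close>), and in that case the finite hulls contain
  arbitrarily large balls (\<open>hull_inradius_inf_eq_infinity_iff\<close>). Oscillation in every
  direction says that each fixed \<open>u \<noteq> 0\<close> is almost surely outside
  \<open>C\<close> (\<open>oscillation_directions_eq_sphere_iff\<close>). It remains to interchange
  "for every \<open>u\<close>" and "almost surely". Since \<open>C\<close> does not change when
  finitely many increments do, Kolmogorov's zero-one law shows that its closure is deterministic;
  the relative interior of \<open>C\<close>, which depends only on the closure, is then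
  deterministic as well. If \<open>C\<close> contained nonzero vectors with positive probability,
  some fixed nonzero direction would be in \<open>C\<close> almost surely
  (\<open>AE_barrier_cone_trivial\<close>).

  If \<open>0\<close> is interior to the hull of the limit directions, then for each \<open>u
  \<noteq> 0\<close> there is a limit direction \<open>v\<close> with \<open>v \<bullet> u >
  0\<close>, so \<open>S\<^sub>n \<bullet> u\<close> is positive infinitely often. If
  \<open>S\<^sub>n \<bullet> u\<close> were bounded above, its upper limit \<open>L\<close> would be
  finite. Splitting off the first increment, \<open>L = X\<^sub>1 \<bullet> u + L'\<close> with
  \<open>L'\<close> independent of \<open>X\<^sub>1\<close> and distributed like \<open>L\<close>;
  comparing characteristic functions gives \<open>X\<^sub>1 \<bullet> u = 0\<close> almost surely,
  which is excluded because the walk is genuinely \<open>d\<close>-dimensional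
  (\<open>AE_not_mem_barrier_cone_if_limit_direction\<close>).

  For the last implication consider the directions in which the walk escapes to infinity along
  subsequences. They are also insensitive to finitely many increments, so they form a deterministic
  compact set \<open>F\<close> of limit directions (\<open>AE_asymptotic_directions_const\<close>).
  A walk that oscillates in every direction has an escape direction in each closed half-space
  bounded by a hyperplane through \<open>0\<close>
  (\<open>asymptotic_direction_in_halfspace\<close>), and therefore \<open>0\<close> cannot be
  strictly separated from \<open>F\<close>.
\<close>

section \<open>The hull of a path and the half-spaces containing it\<close>

lemma walk_hull_mono: "m \<le> n \<Longrightarrow> walk_hull X m \<omega> \<subseteq> walk_hull X n \<omega>"
  unfolding walk_hull_def by (intro hull_mono image_mono) auto

lemma walk_hull_inf_eq_convex_hull:
  "walk_hull_inf X \<omega> = convex hull (range (\<lambda>n. walk X n \<omega>))"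
proof
  show "walk_hull_inf X \<omega> \<subseteq> convex hull (range (\<lambda>n. walk X n \<omega>))"
    unfolding walk_hull_inf_def walk_hull_def by (intro UN_least hull_mono) auto
  have "walk X n \<omega> \<in> walk_hull X n \<omega>" for n
    unfolding walk_hull_def by (intro hull_inc) auto
  then have "range (\<lambda>n. walk X n \<omega>) \<subseteq> walk_hull_inf X \<omega>"
    unfolding walk_hull_inf_def by blast
  moreover have "convex (walk_hull_inf X \<omega>)"
    unfolding convex_def
  proof (intro ballI allI impI)
    fix x y and a b :: real
    assume "x \<in> walk_hull_inf X \<omega>" "y \<in> walk_hull_inf X \<omega>" and ab: "0 \<le> a" "0 \<le> b" "a + b = 1"
    then obtain m n where "x \<in> walk_hull X m \<omega>" "y \<in> walk_hull X n \<omega>"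
      unfolding walk_hull_inf_def by blast
    then have "x \<in> walk_hull X (max m n) \<omega>" "y \<in> walk_hull X (max m n) \<omega>"
      using walk_hull_mono[of m "max m n" X \<omega>] walk_hull_mono[of n "max m n" X \<omega>] by auto
    moreover have "convex (walk_hull X (max m n) \<omega>)"
      unfolding walk_hull_def by (rule convex_convex_hull)
    ultimately have "a *\<^sub>R x + b *\<^sub>R y \<in> walk_hull X (max m n) \<omega>"
      using ab by (simp add: convexD)
    then show "a *\<^sub>R x + b *\<^sub>R y \<in> walk_hull_inf X \<omega>"
      unfolding walk_hull_inf_def by blast
  qed
  ultimately show "convex hull (range (\<lambda>n. walk X n \<omega>)) \<subseteq> walk_hull_inf X \<omega>"
    by (rule hull_minimal)
qed

text \<open>
  A ball lies in a box, and a box is the hull of finitely many points. If the increasing hulls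
  exhaust the space, one of them contains these points, hence the ball. So filling the space
  pointwise is as strong as filling it with inradius tending to infinity.
\<close>

lemma hull_inradius_inf_eq_infinity_iff:
  fixes X :: "nat \<Rightarrow> 'w \<Rightarrow> real ^ 'd"
  shows "hull_inradius_inf X \<omega> = \<infinity> \<longleftrightarrow> walk_hull_inf X \<omega> = UNIV"
proof
  assume "hull_inradius_inf X \<omega> = \<infinity>"
  then have lim: "(\<lambda>n. hull_inradius X n \<omega>) \<longlonglongrightarrow> \<infinity>"
    using hull_inradius_tendsto[of X \<omega>] by simp
  have "x \<in> walk_hull_inf X \<omega>" for x
  proof -
    have "eventually (\<lambda>n. ereal (norm x) < hull_inradius X n \<omega>) sequentially"
      using lim by (simp add: tendsto_PInfty)
    then obtain n where n: "ereal (norm x) < hull_inradius X n \<omega>"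
      by (auto simp: eventually_sequentially)
    have "x \<in> walk_hull X n \<omega>"
    proof (rule ccontr)
      assume "x \<notin> walk_hull X n \<omega>"
      then have "hull_inradius X n \<omega> \<le> ereal (norm x)"
        unfolding hull_inradius_def by (intro INF_lower) auto
      with n show False by simp
    qed
    then show ?thesis unfolding walk_hull_inf_def by blast
  qed
  then show "walk_hull_inf X \<omega> = UNIV" by blast
next
  assume full: "walk_hull_inf X \<omega> = UNIV"
  have "(\<lambda>n. hull_inradius X n \<omega>) \<longlonglongrightarrow> \<infinity>"
    unfolding tendsto_PInfty
  proof
    fix r :: real
    obtain a b :: "real ^ 'd" where ab: "cball 0 (\<bar>r\<bar> + 1) \<subseteq> cbox a b"
      using bounded_subset_cbox_symmetric[OF bounded_cball] by metis
    obtain V where V: "finite V" "cbox a b = convex hull V"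
      by (rule closed_interval_as_convex_hull)
    have "\<exists>n. W \<subseteq> walk_hull X n \<omega>" if "finite W" for W
      using that
    proof induction
      case (insert x W)
      then obtain n where n: "W \<subseteq> walk_hull X n \<omega>" by blast
      obtain m where "x \<in> walk_hull X m \<omega>"
        using full unfolding walk_hull_inf_def by blast
      then have "insert x W \<subseteq> walk_hull X (max m n) \<omega>"
        using n walk_hull_mono[of m "max m n" X \<omega>] walk_hull_mono[of n "max m n" X \<omega>] by auto
      then show ?case by blast
    qed simp
    then obtain N where N: "V \<subseteq> walk_hull X N \<omega>" using V(1) by blast
    then have "convex hull V \<subseteq> walk_hull X N \<omega>"
      by (intro hull_minimal) (auto simp: walk_hull_def)
    then have sub: "cball 0 (\<bar>r\<bar> + 1) \<subseteq> walk_hull X n \<omega>" if "n \<ge> N" for n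
      using ab V(2) walk_hull_mono[OF that, of X \<omega>] by blast
    have "ereal r < hull_inradius X n \<omega>" if "n \<ge> N" for n
    proof -
      have "ereal (\<bar>r\<bar> + 1) \<le> hull_inradius X n \<omega>"
        unfolding hull_inradius_def
      proof (rule INF_greatest)
        fix x assume "x \<in> UNIV - walk_hull X n \<omega>"
        then have "x \<notin> cball 0 (\<bar>r\<bar> + 1)" using sub[OF that] by blast
        then show "ereal (\<bar>r\<bar> + 1) \<le> ereal (norm x)" by simp
      qed
      moreover have "ereal r < ereal (\<bar>r\<bar> + 1)" by simp
      ultimately show ?thesis by (rule less_le_trans[rotated])
    qed
    then show "eventually (\<lambda>n. ereal r < hull_inradius X n \<omega>) sequentially"
      by (auto simp: eventually_sequentially)
  qed
  then show "hull_inradius_inf X \<omega> = \<infinity>"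
    by (rule LIMSEQ_unique[OF hull_inradius_tendsto])
qed

text \<open>
  The directions in which the path is bounded above, which is the barrier cone of the hull of the
  path: \<open>u\<close> belongs to it when some half-space with outer normal \<open>u\<close>
  contains the whole path. Taking the bound to be a natural number makes membership a countable
  union, as needed for measurability.
\<close>

definition barrier_cone :: "(nat \<Rightarrow> 'a::real_inner) \<Rightarrow> 'a set" where
  "barrier_cone s = {u. \<exists>N::nat. \<forall>n. s n \<bullet> u \<le> real N}"

lemma mem_barrier_coneI: "(\<And>n. s n \<bullet> u \<le> c) \<Longrightarrow> u \<in> barrier_cone s"
  unfolding barrier_cone_def using real_arch_simple[of c] by (blast intro: order_trans)

lemma barrier_cone_scaleR:
  assumes "u \<in> barrier_cone s" "0 \<le> c" shows "c *\<^sub>R u \<in> barrier_cone s"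
proof -
  obtain N where N: "\<And>n. s n \<bullet> u \<le> real N" using assms(1) unfolding barrier_cone_def by blast
  show ?thesis
    by (rule mem_barrier_coneI[of _ _ "c * real N"]) (simp add: N assms(2) mult_left_mono)
qed

lemma convex_barrier_cone: "convex (barrier_cone s)"
  unfolding convex_def
proof (intro ballI allI impI)
  fix x y and a b :: real
  assume x: "x \<in> barrier_cone s" and y: "y \<in> barrier_cone s" and ab: "0 \<le> a" "0 \<le> b"
  obtain N where N: "\<And>n. s n \<bullet> x \<le> real N" using x unfolding barrier_cone_def by blast
  obtain K where K: "\<And>n. s n \<bullet> y \<le> real K" using y unfolding barrier_cone_def by blast
  show "a *\<^sub>R x + b *\<^sub>R y \<in> barrier_cone s"
    by (rule mem_barrier_coneI[of _ _ "a * real N + b * real K"])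
       (simp add: inner_add_right add_mono N K ab mult_left_mono)
qed

text \<open>
  Dropping the first position and translating the rest changes the bounds on the path but not their
  existence. This is what makes every event expressed through the barrier cone of a random walk a
  tail event of its increments.
\<close>

lemma barrier_cone_shift:
  "barrier_cone (\<lambda>n. s (Suc n) + c) = barrier_cone s"
proof (intro equalityI subsetI)
  fix u assume "u \<in> barrier_cone (\<lambda>n. s (Suc n) + c)"
  then obtain N where N: "\<And>n. (s (Suc n) + c) \<bullet> u \<le> real N" unfolding barrier_cone_def by blast
  show "u \<in> barrier_cone s"
  proof (rule mem_barrier_coneI)
    fix n show "s n \<bullet> u \<le> max (s 0 \<bullet> u) (real N - c \<bullet> u)"
      using N by (cases n) (auto simp: inner_add_left le_max_iff_disj algebra_simps)
  qed
next
  fix u assume "u \<in> barrier_cone s"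
  then obtain N where N: "\<And>n. s n \<bullet> u \<le> real N" unfolding barrier_cone_def by blast
  show "u \<in> barrier_cone (\<lambda>n. s (Suc n) + c)"
    by (rule mem_barrier_coneI[of _ _ "real N + c \<bullet> u"]) (simp add: N inner_add_left)
qed

text \<open>
  A convex set that misses a point is separated from it by a hyperplane, and the hyperplane confines
  the path to a half-space.
\<close>

lemma convex_hull_range_eq_UNIV_iff:
  fixes s :: "nat \<Rightarrow> 'a::euclidean_space"
  shows "convex hull (range s) = UNIV \<longleftrightarrow> barrier_cone s \<subseteq> {0}"
proof
  assume full: "convex hull (range s) = UNIV"
  show "barrier_cone s \<subseteq> {0}"
  proof
    fix u assume "u \<in> barrier_cone s"
    then obtain N where N: "\<And>n. s n \<bullet> u \<le> real N" unfolding barrier_cone_def by blast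
    have "convex hull (range s) \<subseteq> {x. u \<bullet> x \<le> real N}"
    proof (rule hull_minimal)
      show "range s \<subseteq> {x. u \<bullet> x \<le> real N}" using N by (auto simp: inner_commute)
    qed (rule convex_halfspace_le)
    then have le: "u \<bullet> x \<le> real N" for x using full by auto
    show "u \<in> {0}"
    proof (rule ccontr)
      assume "u \<notin> {0}"
      then have "u \<bullet> (((real N + 1) / (u \<bullet> u)) *\<^sub>R u) = real N + 1" by simp
      with le[of "((real N + 1) / (u \<bullet> u)) *\<^sub>R u"] show False by linarith
    qed
  qed
next
  assume trivial: "barrier_cone s \<subseteq> {0}"
  show "convex hull (range s) = UNIV"
  proof (rule ccontr)
    assume "convex hull (range s) \<noteq> UNIV"
    then obtain x where "x \<notin> convex hull (range s)" by blast
    then obtain a b where a: "a \<noteq> 0" and le: "\<forall>y\<in>convex hull (range s). a \<bullet> y \<le> b"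
      using separating_hyperplane_sets[of "convex hull (range s)" "{x}"] by auto
    have "a \<in> barrier_cone s"
      using le by (intro mem_barrier_coneI[of _ _ b]) (auto simp: inner_commute hull_inc)
    with trivial a show False by blast
  qed
qed

lemma limsup_ereal_eq_infinity_iff:
  fixes x :: "nat \<Rightarrow> real"
  shows "limsup (\<lambda>n. ereal (x n)) = \<infinity> \<longleftrightarrow> (\<forall>N::nat. \<exists>n. x n > real N)"
proof
  assume L: "limsup (\<lambda>n. ereal (x n)) = \<infinity>"
  show "\<forall>N::nat. \<exists>n. x n > real N"
  proof (rule ccontr)
    assume "\<not> (\<forall>N::nat. \<exists>n. x n > real N)"
    then obtain N where N: "\<And>n. x n \<le> real N" by (auto simp: not_less)
    have "limsup (\<lambda>n. ereal (x n)) \<le> ereal (real N)"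
      by (rule Limsup_bounded) (simp add: N)
    with L show False by simp
  qed
next
  assume unb: "\<forall>N::nat. \<exists>n. x n > real N"
  show "limsup (\<lambda>n. ereal (x n)) = \<infinity>"
  proof (rule ccontr)
    assume "limsup (\<lambda>n. ereal (x n)) \<noteq> \<infinity>"
    then obtain c where "limsup (\<lambda>n. ereal (x n)) < ereal c"
      unfolding less_PInf_Ex_of_nat by blast
    then have "eventually (\<lambda>n. ereal (x n) < ereal c) sequentially"
      by (rule Limsup_lessD)
    then obtain n0 where n0: "\<And>n. n \<ge> n0 \<Longrightarrow> x n < c"
      by (auto simp: eventually_sequentially)
    obtain N :: nat where N: "Max (insert c (x ` {..n0})) \<le> real N"
      using real_arch_simple by blast
    have "x n \<le> real N" for n
    proof (cases "n \<le> n0")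
      case True
      then have "x n \<le> Max (insert c (x ` {..n0}))" by (intro Max_ge) auto
      with N show ?thesis by linarith
    next
      case False
      then have "x n \<le> c" using n0[of n] by simp
      moreover have "c \<le> Max (insert c (x ` {..n0}))" by (intro Max_ge) auto
      ultimately show ?thesis using N by linarith
    qed
    with unb show False by (meson not_less)
  qed
qed

lemma limsup_inner_eq_infinity_iff:
  "limsup (\<lambda>n. ereal (s n \<bullet> u)) = \<infinity> \<longleftrightarrow> u \<notin> barrier_cone s"
  unfolding limsup_ereal_eq_infinity_iff barrier_cone_def by (auto simp: not_le)

lemma liminf_inner_eq_minus_infinity_iff:
  "liminf (\<lambda>n. ereal (s n \<bullet> u)) = -\<infinity> \<longleftrightarrow> - u \<notin> barrier_cone s"
proof -
  have "limsup (\<lambda>n. ereal (s n \<bullet> - u)) = - liminf (\<lambda>n. ereal (s n \<bullet> u))"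
    unfolding ereal_Limsup_uminus[symmetric] by simp
  then have "liminf (\<lambda>n. ereal (s n \<bullet> u)) = -\<infinity> \<longleftrightarrow> limsup (\<lambda>n. ereal (s n \<bullet> - u)) = \<infinity>"
    by (simp add: ereal_uminus_eq_reorder)
  then show ?thesis unfolding limsup_inner_eq_infinity_iff .
qed

text \<open>
  Oscillation in the direction \<open>u\<close> means that neither \<open>u\<close> nor
  \<open>-u\<close> is in the barrier cone; quantifying over all directions absorbs the sign.
\<close>

lemma oscillation_directions_eq_sphere_iff:
  fixes X :: "nat \<Rightarrow> 'w \<Rightarrow> real ^ 'd"
  shows "oscillation_directions M X = sphere 0 1 \<longleftrightarrow>
     (\<forall>u. u \<noteq> 0 \<longrightarrow> (AE \<omega> in M. u \<notin> barrier_cone (\<lambda>n. walk X n \<omega>)))"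
proof -
  have osc: "u \<in> oscillation_directions M X \<longleftrightarrow> norm u = 1 \<and>
      (AE \<omega> in M. - u \<notin> barrier_cone (\<lambda>n. walk X n \<omega>) \<and> u \<notin> barrier_cone (\<lambda>n. walk X n \<omega>))" for u
    unfolding oscillation_directions_def
    by (simp add: limsup_inner_eq_infinity_iff liminf_inner_eq_minus_infinity_iff)
  show ?thesis
  proof
    assume sph: "oscillation_directions M X = sphere 0 1"
    show "\<forall>u. u \<noteq> 0 \<longrightarrow> (AE \<omega> in M. u \<notin> barrier_cone (\<lambda>n. walk X n \<omega>))"
    proof (intro allI impI)
      fix u :: "real ^ 'd" assume "u \<noteq> 0"
      then have "sgn u \<in> oscillation_directions M X" using sph by (simp add: norm_sgn)
      then have "AE \<omega> in M. sgn u \<notin> barrier_cone (\<lambda>n. walk X n \<omega>)"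
        unfolding osc by auto
      then show "AE \<omega> in M. u \<notin> barrier_cone (\<lambda>n. walk X n \<omega>)"
        by eventually_elim (metis barrier_cone_scaleR norm_ge_zero inverse_nonnegative_iff_nonnegative sgn_div_norm)
    qed
  next
    assume *: "\<forall>u. u \<noteq> 0 \<longrightarrow> (AE \<omega> in M. u \<notin> barrier_cone (\<lambda>n. walk X n \<omega>))"
    have "u \<in> oscillation_directions M X" if "norm u = 1" for u
    proof -
      have "u \<noteq> 0" "- u \<noteq> 0" using that by auto
      then show ?thesis using * that unfolding osc by (auto intro: AE_conjI)
    qed
    then show "oscillation_directions M X = sphere 0 1"
      using osc by auto
  qed
qed

section \<open>Directions in which a path escapes to infinity\<close>

text \<open>
  The limits of \<open>sgn (s n)\<close> along subsequences on which \<open>norm (s n)\<close> tends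
  to infinity. Since finitely many positions are bounded, a single index \<open>n\<close> for each
  \<open>R\<close> already means infinitely many. The growth of the norm distinguishes this set from
  the limit points of \<open>sgn (s n)\<close>, which are not invariant under translation of the
  path when the path returns to a bounded region.
\<close>

definition asymptotic_directions :: "(nat \<Rightarrow> 'a::real_normed_vector) \<Rightarrow> 'a set" where
  "asymptotic_directions s =
     {u. \<forall>e>0. \<forall>R. \<exists>n. R < norm (s n) \<and> norm (sgn (s n) - u) < e}"

lemma asymptotic_directionsE:
  assumes "u \<in> asymptotic_directions s" "e > 0"
  obtains n where "R < norm (s n)" "norm (sgn (s n) - u) < e"
  using assms unfolding asymptotic_directions_def by blast

lemma norm_sgn_diff_le:
  fixes x y :: "'a::real_normed_vector"
  assumes "x \<noteq> 0"
  shows "norm (sgn y - sgn x) \<le> 2 * norm (y - x) / norm x"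
proof (cases "y = 0")
  case True
  then show ?thesis using assms by (simp add: norm_sgn)
next
  case False
  have "sgn y - sgn x = (y - x) /\<^sub>R norm x + (norm x - norm y) *\<^sub>R (y /\<^sub>R (norm x * norm y))"
  proof -
    have "(norm x - norm y) * inverse (norm x * norm y) = inverse (norm y) - inverse (norm x)"
      using assms False by (simp add: field_simps)
    then show ?thesis
      by (simp add: sgn_div_norm scaleR_right_diff_distrib scaleR_left_diff_distrib)
  qed
  also have "norm \<dots> \<le> norm (y - x) / norm x + \<bar>norm x - norm y\<bar> / norm x"
    using assms False
    by (intro order_trans[OF norm_triangle_ineq] add_mono) (simp_all add: divide_simps)
  also have "\<dots> \<le> norm (y - x) / norm x + norm (y - x) / norm x"
    using norm_triangle_ineq3[of x y] by (intro add_mono divide_right_mono) (auto simp: norm_minus_commute)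
  finally show ?thesis by simp
qed

text \<open>
  A translation by \<open>c\<close> turns the direction of a point at distance \<open>r\<close> by
  an amount of order \<open>norm c / r\<close>, which disappears along subsequences escaping to
  infinity.
\<close>

lemma asymptotic_directions_shift:
  "asymptotic_directions (\<lambda>n. s (Suc n) + c) = asymptotic_directions s"
proof -
  have index: "asymptotic_directions (\<lambda>n. s (Suc n)) = asymptotic_directions s" for s :: "nat \<Rightarrow> 'a"
  proof (intro equalityI subsetI)
    fix u assume u: "u \<in> asymptotic_directions s"
    show "u \<in> asymptotic_directions (\<lambda>n. s (Suc n))"
      unfolding asymptotic_directions_def
    proof (intro CollectI allI impI)
      fix e R :: real assume "e > 0"
      then obtain n where n: "max R (norm (s 0)) < norm (s n)" "norm (sgn (s n) - u) < e"
        using u unfolding asymptotic_directions_def by blast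
      then obtain m where "n = Suc m" by (cases n) auto
      with n show "\<exists>n. R < norm (s (Suc n)) \<and> norm (sgn (s (Suc n)) - u) < e" by auto
    qed
  next
    fix u assume u: "u \<in> asymptotic_directions (\<lambda>n. s (Suc n))"
    show "u \<in> asymptotic_directions s"
      unfolding asymptotic_directions_def
    proof (intro CollectI allI impI)
      fix e R :: real assume "e > 0"
      then obtain n where "R < norm (s (Suc n))" "norm (sgn (s (Suc n)) - u) < e"
        using u unfolding asymptotic_directions_def by blast
      then show "\<exists>n. R < norm (s n) \<and> norm (sgn (s n) - u) < e" by blast
    qed
  qed
  have sub: "asymptotic_directions s \<subseteq> asymptotic_directions (\<lambda>n. s n + c)" for s :: "nat \<Rightarrow> 'a" and c
  proof
    fix u assume u: "u \<in> asymptotic_directions s"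
    show "u \<in> asymptotic_directions (\<lambda>n. s n + c)"
      unfolding asymptotic_directions_def
    proof (intro CollectI allI impI)
      fix e R :: real assume e: "e > 0"
      obtain n where n: "max 0 (max (R + norm c) (4 * norm c / e)) < norm (s n)"
          "norm (sgn (s n) - u) < e / 2"
        using asymptotic_directionsE[OF u half_gt_zero[OF e]] by metis
      then have pos: "0 < norm (s n)" and far: "R + norm c < norm (s n)" "4 * norm c / e < norm (s n)"
        by auto
      have "R < norm (s n + c)"
        using far(1) norm_triangle_ineq4[of "s n + c" c] by simp
      moreover have "norm (sgn (s n + c) - sgn (s n)) \<le> e / 2"
      proof -
        have "norm (sgn (s n + c) - sgn (s n)) \<le> 2 * norm c / norm (s n)"
          using norm_sgn_diff_le[of "s n" "s n + c"] pos by simp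
        also have "\<dots> \<le> e / 2"
          using far(2) pos e by (simp add: field_simps)
        finally show ?thesis .
      qed
      then have "norm (sgn (s n + c) - u) < e"
        using n(2) norm_triangle_ineq[of "sgn (s n + c) - sgn (s n)" "sgn (s n) - u"] by simp
      ultimately show "\<exists>n. R < norm (s n + c) \<and> norm (sgn (s n + c) - u) < e" by blast
    qed
  qed
  have "asymptotic_directions (\<lambda>n. s n + c) = asymptotic_directions s"
    using sub[of s c] sub[of "\<lambda>n. s n + c" "- c"] by auto
  then show ?thesis using index[of "\<lambda>n. s n + c"] by simp
qed

lemma closed_asymptotic_directions: "closed (asymptotic_directions s)"
  unfolding closed_limpt
proof (intro allI impI)
  fix u assume lim: "u islimpt asymptotic_directions s"
  show "u \<in> asymptotic_directions s"
    unfolding asymptotic_directions_def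
  proof (intro CollectI allI impI)
    fix e R :: real assume e: "e > 0"
    then obtain v where v: "v \<in> asymptotic_directions s" "dist v u < e / 2"
      using lim unfolding islimpt_approachable by (meson half_gt_zero)
    then obtain n where "R < norm (s n)" "norm (sgn (s n) - v) < e / 2"
      using asymptotic_directionsE[OF v(1) half_gt_zero[OF e]] by metis
    moreover have "norm (sgn (s n) - u) \<le> norm (sgn (s n) - v) + norm (v - u)"
      using norm_triangle_ineq[of "sgn (s n) - v" "v - u"] by simp
    ultimately show "\<exists>n. R < norm (s n) \<and> norm (sgn (s n) - u) < e"
      using v(2) by (intro exI[of _ n]) (simp add: dist_norm)
  qed
qed

lemma asymptotic_directions_subset_sphere: "asymptotic_directions s \<subseteq> sphere 0 1"
proof
  fix u assume u: "u \<in> asymptotic_directions s"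
  have "\<bar>1 - norm u\<bar> \<le> e" if e: "e > 0" for e
  proof -
    obtain n where "0 < norm (s n)" "norm (sgn (s n) - u) < e"
      using u e unfolding asymptotic_directions_def by blast
    then show ?thesis using norm_triangle_ineq3[of "sgn (s n)" u] by (simp add: norm_sgn)
  qed
  then have "\<bar>1 - norm u\<bar> \<le> 0" by (rule field_le_epsilon[of _ 0, simplified])
  then show "u \<in> sphere 0 1" by simp
qed

lemma liminf_sgn_eq_0_iff:
  fixes s :: "nat \<Rightarrow> 'a::real_normed_vector"
  shows "liminf (\<lambda>n. ereal (norm (sgn (s n) - u))) = 0 \<longleftrightarrow>
    (\<forall>e>0. \<exists>\<^sub>F n in sequentially. norm (sgn (s n) - u) < e)"
proof -
  have "0 \<le> liminf (\<lambda>n. ereal (norm (sgn (s n) - u)))"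
    by (intro Liminf_bounded) simp
  then have "liminf (\<lambda>n. ereal (norm (sgn (s n) - u))) = 0 \<longleftrightarrow>
      liminf (\<lambda>n. ereal (norm (sgn (s n) - u))) \<le> 0" by auto
  also have "\<dots> \<longleftrightarrow> (\<forall>e>0. \<exists>\<^sub>F n in sequentially. norm (sgn (s n) - u) < e)"
  proof
    assume L: "liminf (\<lambda>n. ereal (norm (sgn (s n) - u))) \<le> 0"
    show "\<forall>e>0. \<exists>\<^sub>F n in sequentially. norm (sgn (s n) - u) < e"
    proof (intro allI impI, rule ccontr)
      fix e :: real assume e: "e > 0" and "\<not> (\<exists>\<^sub>F n in sequentially. norm (sgn (s n) - u) < e)"
      then have "\<forall>\<^sub>F n in sequentially. ereal e \<le> ereal (norm (sgn (s n) - u))"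
        by (simp add: not_frequently not_less)
      then have "ereal e \<le> liminf (\<lambda>n. ereal (norm (sgn (s n) - u)))" by (rule Liminf_bounded)
      then have "ereal e \<le> 0" using L by (rule order_trans)
      with e show False by simp
    qed
  next
    assume freq: "\<forall>e>0. \<exists>\<^sub>F n in sequentially. norm (sgn (s n) - u) < e"
    show "liminf (\<lambda>n. ereal (norm (sgn (s n) - u))) \<le> 0"
    proof (rule ccontr)
      assume "\<not> liminf (\<lambda>n. ereal (norm (sgn (s n) - u))) \<le> 0"
      then obtain e where e: "0 < ereal e" "ereal e < liminf (\<lambda>n. ereal (norm (sgn (s n) - u)))"
        using ereal_dense2[of 0 "liminf (\<lambda>n. ereal (norm (sgn (s n) - u)))"]
        unfolding not_le by blast
      have "\<forall>\<^sub>F n in sequentially. ereal e < ereal (norm (sgn (s n) - u))"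
        using e(2) by (rule less_LiminfD)
      then have "\<forall>\<^sub>F n in sequentially. \<not> norm (sgn (s n) - u) < e"
        by eventually_elim simp
      then show False using freq e(1) by (simp add: frequently_def)
    qed
  qed
  finally show ?thesis .
qed

lemma liminf_sgn_eq_0_if_asymptotic_direction:
  assumes "u \<in> asymptotic_directions s"
  shows "liminf (\<lambda>n. ereal (norm (sgn (s n) - u))) = 0"
  unfolding liminf_sgn_eq_0_iff frequently_sequentially
proof (intro allI impI)
  fix e :: real and m assume "e > 0"
  then obtain n where n: "Max ((\<lambda>k. norm (s k)) ` {..m}) < norm (s n)" "norm (sgn (s n) - u) < e"
    using assms unfolding asymptotic_directions_def by blast
  have "m \<le> n"
  proof (rule ccontr)
    assume "\<not> m \<le> n"
    then have "norm (s n) \<le> Max ((\<lambda>k. norm (s k)) ` {..m})" by (intro Max_ge) auto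
    with n(1) show False by (metis not_less)
  qed
  with n(2) show "\<exists>n\<ge>m. norm (sgn (s n) - u) < e" by blast
qed

text \<open>
  Choose times at which \<open>s n \<bullet> a\<close> exceeds any given bound. The norm then tends
  to infinity, and compactness of the sphere provides a limit direction, whose inner product with
  \<open>a\<close> is a limit of positive numbers.
\<close>

lemma asymptotic_direction_in_halfspace:
  fixes s :: "nat \<Rightarrow> 'a::euclidean_space"
  assumes "a \<notin> barrier_cone s"
  shows "\<exists>w\<in>asymptotic_directions s. 0 \<le> w \<bullet> a"
proof -
  have "\<exists>n. real m * norm a < s n \<bullet> a" for m
    using assms mem_barrier_coneI[of s a "real m * norm a"] by (force simp: not_le)
  then obtain f where f: "\<And>m. real m * norm a < s (f m) \<bullet> a" by metis
  have a: "a \<noteq> 0" using f[of 0] by auto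
  have far: "real m < norm (s (f m))" for m
  proof -
    have "real m * norm a < norm (s (f m)) * norm a"
      using f[of m] norm_cauchy_schwarz[of "s (f m)" a] by linarith
    then show ?thesis using a by simp
  qed
  have "sgn (s (f m)) \<in> sphere 0 1" for m using far[of m] by (auto simp: norm_sgn)
  then obtain w r where r: "strict_mono (r :: nat \<Rightarrow> nat)"
      and lim: "((\<lambda>m. sgn (s (f m))) \<circ> r) \<longlonglongrightarrow> w"
    using compact_sphere[of "0::'a" 1] unfolding compact_def by metis
  have "w \<in> asymptotic_directions s"
    unfolding asymptotic_directions_def
  proof (intro CollectI allI impI)
    fix e R :: real assume "e > 0"
    with lim have "\<forall>\<^sub>F m in sequentially. dist (((\<lambda>m. sgn (s (f m))) \<circ> r) m) w < e"
      by (rule tendstoD)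
    then have "\<forall>\<^sub>F m in sequentially. norm (sgn (s (f (r m))) - w) < e"
      by (simp add: dist_norm)
    moreover have "\<forall>\<^sub>F m in sequentially. R \<le> real m"
      using eventually_ge_at_top[of "nat \<lceil>R\<rceil>"] by eventually_elim linarith
    ultimately have "\<forall>\<^sub>F m in sequentially. R \<le> real m \<and> norm (sgn (s (f (r m))) - w) < e"
      by (rule eventually_conj[rotated])
    then obtain m where m: "R \<le> real m" "norm (sgn (s (f (r m))) - w) < e"
      by (metis (mono_tags, lifting) eventually_happens' sequentially_bot)
    have "R < norm (s (f (r m)))"
      using m(1) far[of "r m"] seq_suble[OF r, of m] by linarith
    with m(2) show "\<exists>n. R < norm (s n) \<and> norm (sgn (s n) - w) < e" by blast
  qed
  moreover have "0 \<le> w \<bullet> a"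
  proof (rule tendsto_lowerbound)
    show "(\<lambda>m. sgn (s (f (r m))) \<bullet> a) \<longlonglongrightarrow> w \<bullet> a"
      using lim by (intro tendsto_inner tendsto_const) (simp add: comp_def)
    have "0 \<le> s (f m) \<bullet> a" for m
      using f[of m] by (meson less_imp_le mult_nonneg_nonneg norm_ge_zero of_nat_0_le_iff order_trans)
    then show "\<forall>\<^sub>F m in sequentially. 0 \<le> sgn (s (f (r m))) \<bullet> a"
      by (simp add: sgn_div_norm)
  qed simp
  ultimately show ?thesis by blast
qed

section \<open>Zero-one laws for sets attached to a random walk\<close>

lemma (in prob_space) indep_vars_reindex_inj:
  assumes indep: "indep_vars (\<lambda>_. N) X I" and f: "inj_on f J" "f ` J \<subseteq> I"
  shows "indep_vars (\<lambda>_. N) (\<lambda>j. X (f j)) J"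
proof -
  have "indep_vars (\<lambda>_. N) (\<lambda>j \<omega>. (\<lambda>g. g (f j)) (restrict (\<lambda>i. X i \<omega>) {f j})) J"
    using f by (intro indep_vars_compose2[OF indep_vars_restrict[OF indep]])
      (auto simp: disjoint_family_on_def inj_on_def)
  then show ?thesis by simp
qed

text \<open>
  Kolmogorov's zero-one law for the path: if \<open>\<Phi>\<close> ignores the first position and
  translations, then it may be evaluated on the sums that start at any time \<open>N\<close>, so the
  event is measurable with respect to the increments from \<open>N\<close> on, for every
  \<open>N\<close>.
\<close>

lemma (in prob_space) AE_or_AE_not_if_path_invariant:
  fixes Y :: "nat \<Rightarrow> 'a \<Rightarrow> 'b::euclidean_space"
  assumes indep: "indep_vars (\<lambda>_. borel) Y UNIV"
    and meas[measurable]: "Measurable.pred (\<Pi>\<^sub>M i\<in>UNIV. borel) \<Phi>"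
    and invariant: "\<And>s c. \<Phi> (\<lambda>n. s (Suc n) + c) \<longleftrightarrow> \<Phi> s"
  shows "(AE \<omega> in M. \<Phi> (\<lambda>n. \<Sum>i<n. Y i \<omega>)) \<or> (AE \<omega> in M. \<not> \<Phi> (\<lambda>n. \<Sum>i<n. Y i \<omega>))"
proof -
  define A where "A i = sigma_sets (space M) {Y i -` B \<inter> space M |B. B \<in> sets borel}" for i
  define E where "E = {\<omega> \<in> space M. \<Phi> (\<lambda>n. \<Sum>i<n. Y i \<omega>)}"
  have Y[measurable]: "Y i \<in> borel_measurable M" for i
    using indep unfolding indep_vars_def2 by blast
  have A_sets: "A i \<subseteq> sets M" for i
    unfolding A_def by (intro sets.sigma_sets_subset) (auto intro: measurable_sets[OF Y])
  have invariant': "\<Phi> (\<lambda>n. s (n + N) + c) \<longleftrightarrow> \<Phi> s" for s :: "nat \<Rightarrow> 'b" and N c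
  proof (induction N)
    case 0
    show ?case using invariant[of "\<lambda>n. s n + c" 0] invariant[of s c] by simp
  next
    case (Suc N)
    then show ?case using invariant[of "\<lambda>n. s (n + N) + c" 0] by simp
  qed
  have "E \<in> sigma_sets (space M) (\<Union> (A ` {N..}))" for N
  proof -
    let ?S = "sigma (space M) (\<Union> (A ` {N..}))"
    have sub: "\<Union> (A ` {N..}) \<subseteq> Pow (space M)"
      using A_sets sets.sets_into_space by blast
    have [measurable]: "Y (i + N) \<in> borel_measurable ?S" for i
    proof (rule measurableI)
      fix B :: "'b set" assume "B \<in> sets borel"
      then have "Y (i + N) -` B \<inter> space M \<in> A (i + N)"
        unfolding A_def by (intro sigma_sets.Basic) auto
      then have "Y (i + N) -` B \<inter> space M \<in> \<Union> (A ` {N..})" by auto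
      then show "Y (i + N) -` B \<inter> space ?S \<in> sets ?S"
        using sub by (simp add: space_measure_of sets_measure_of sigma_sets.Basic)
    qed simp
    have "E = {\<omega> \<in> space ?S. \<Phi> (\<lambda>n. \<Sum>i<n. Y (i + N) \<omega>)}"
    proof -
      \<comment> \<open>The invariance is applied with the random translation that brings the position at time \<open>N\<close> to the origin.\<close>
      have "(\<Sum>i<n + N. Y i \<omega>) + - (\<Sum>i<N. Y i \<omega>) = (\<Sum>i<n. Y (i + N) \<omega>)" for n \<omega>
        by (induction n) simp_all
      then have "\<Phi> (\<lambda>n. \<Sum>i<n. Y i \<omega>) \<longleftrightarrow> \<Phi> (\<lambda>n. \<Sum>i<n. Y (i + N) \<omega>)" for \<omega>
        using invariant'[of "\<lambda>n. \<Sum>i<n. Y i \<omega>" N "- (\<Sum>i<N. Y i \<omega>)"] by simp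
      then show ?thesis unfolding E_def using sub by (simp add: space_measure_of)
    qed
    also have "\<dots> \<in> sets ?S"
    proof -
      have [measurable]: "(\<lambda>\<omega> n. \<Sum>i<n. Y (i + N) \<omega>) \<in> measurable ?S (\<Pi>\<^sub>M i\<in>UNIV. borel)"
        by (rule measurable_PiM_single') auto
      show ?thesis by measurable
    qed
    also have "sets ?S = sigma_sets (space M) (\<Union> (A ` {N..}))"
      using sub by (rule sets_measure_of)
    finally show ?thesis .
  qed
  then have tail: "E \<in> tail_events A" unfolding tail_events_def by blast
  have "indep_sets A UNIV"
    using indep unfolding indep_vars_def A_def by simp
  moreover have "sigma_algebra (space M) (A i)" for i
    unfolding A_def by (intro sigma_algebra_sigma_sets) auto
  ultimately have "prob E = 0 \<or> prob E = 1"
    using tail by (intro kolmogorov_0_1_law) auto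
  moreover have "E \<in> events" using tail_events_sets[of A] A_sets tail by blast
  ultimately show ?thesis
    unfolding E_def by (auto simp: prob_Collect_eq_0 prob_Collect_eq_1)
qed

text \<open>
  A random set for which meeting a given compact set is always a trivial event has a deterministic
  closure. Countably many small balls decide which points belong to the closure, and outside one
  null set the random set meets exactly those balls that it meets almost surely.
\<close>

lemma (in prob_space) AE_closure_random_set_const:
  fixes R :: "'a \<Rightarrow> 'b::euclidean_space set"
  assumes zero_one: "\<And>K. compact K \<Longrightarrow>
      (AE \<omega> in M. R \<omega> \<inter> K \<noteq> {}) \<or> (AE \<omega> in M. R \<omega> \<inter> K = {})"
  obtains F where "AE \<omega> in M. closure (R \<omega>) = F"
proof -
  obtain D :: "'b set" where D: "countable D" "\<And>U. open U \<Longrightarrow> U \<noteq> {} \<Longrightarrow> \<exists>d\<in>D. d \<in> U"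
    using countable_dense_exists by metis
  define \<B> where "\<B> = (\<lambda>(q, k::nat). cball q (1 / real (Suc k))) ` (D \<times> UNIV)"
  define hit where "hit B \<longleftrightarrow> (AE \<omega> in M. R \<omega> \<inter> B \<noteq> {})" for B
  have "AE \<omega> in M. \<forall>B\<in>\<B>. R \<omega> \<inter> B \<noteq> {} \<longleftrightarrow> hit B"
  proof (rule AE_ball_countable')
    show "countable \<B>" unfolding \<B>_def using D(1) by blast
    fix B assume "B \<in> \<B>"
    then have B: "compact B" unfolding \<B>_def by auto
    show "AE \<omega> in M. R \<omega> \<inter> B \<noteq> {} \<longleftrightarrow> hit B"
    proof (cases "hit B")
      case True
      then show ?thesis unfolding hit_def by simp
    next
      case False
      then have "AE \<omega> in M. R \<omega> \<inter> B = {}" using zero_one[OF B] unfolding hit_def by blast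
      then show ?thesis using False by simp
    qed
  qed
  moreover have "closure (R \<omega>) = {x. \<forall>e>0. \<exists>B\<in>\<B>. hit B \<and> B \<subseteq> ball x e}"
    if hits: "\<forall>B\<in>\<B>. R \<omega> \<inter> B \<noteq> {} \<longleftrightarrow> hit B" for \<omega>
  proof (intro equalityI subsetI CollectI allI impI)
    fix x and e :: real assume x: "x \<in> closure (R \<omega>)" and e: "e > 0"
    obtain k where "1 / real (Suc k) < e / 4"
      using e nat_approx_posE[of "e / 4"] by auto
    moreover define r where "r = 1 / real (Suc k)"
    ultimately have r: "0 < r" "r < e / 4" by auto
    obtain y where y: "y \<in> R \<omega>" "dist y x < r"
      using x r(1) unfolding closure_approachable by blast
    obtain q where q: "q \<in> D" "dist y q < r"
      using D(2)[of "ball y r"] r(1) by auto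
    have "cball q r \<in> \<B>" unfolding \<B>_def r_def using q(1) by force
    moreover have "y \<in> R \<omega> \<inter> cball q r" using y(1) q(2) by (simp add: dist_commute)
    moreover have "cball q r \<subseteq> ball x e"
    proof
      fix z assume "z \<in> cball q r"
      then show "z \<in> ball x e"
        using r y(2) q(2) dist_triangle[of x z y] dist_triangle[of y z q] by (simp add: dist_commute)
    qed
    ultimately show "\<exists>B\<in>\<B>. hit B \<and> B \<subseteq> ball x e" using hits by blast
  next
    fix x assume x: "x \<in> {x. \<forall>e>0. \<exists>B\<in>\<B>. hit B \<and> B \<subseteq> ball x e}"
    show "x \<in> closure (R \<omega>)"
      unfolding closure_approachable
    proof (intro allI impI)
      fix e :: real assume "e > 0"
      then obtain B where "B \<in> \<B>" "hit B" "B \<subseteq> ball x e" using x by blast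
      then obtain y where "y \<in> R \<omega>" "y \<in> ball x e" using hits by blast
      then show "\<exists>y\<in>R \<omega>. dist y x < e" by (auto simp: dist_commute)
    qed
  qed
  ultimately have "AE \<omega> in M. closure (R \<omega>) = {x. \<forall>e>0. \<exists>B\<in>\<B>. hit B \<and> B \<subseteq> ball x e}"
    by (auto elim!: eventually_mono)
  then show thesis by (rule that)
qed

text \<open>
  The existential quantifier ranges over an uncountable set. By compactness of \<open>K\<close> it
  can be replaced by approximate solutions of finitely many inequalities at a time, and those can be
  found in a countable dense subset of \<open>K\<close>.
\<close>

lemma pred_bex_compact_all_le_0:
  fixes f :: "nat \<Rightarrow> 'b::euclidean_space \<Rightarrow> 'a \<Rightarrow> real"
  assumes K: "compact K"
    and cont: "\<And>n \<omega>. continuous_on K (\<lambda>u. f n u \<omega>)"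
    and [measurable]: "\<And>n u. f n u \<in> borel_measurable M"
  shows "Measurable.pred M (\<lambda>\<omega>. \<exists>u\<in>K. \<forall>n. f n u \<omega> \<le> 0)"
proof -
  obtain Q where Q: "countable Q" "Q \<subseteq> K" "K \<subseteq> closure Q" by (rule separable)
  have "(\<exists>u\<in>K. \<forall>n. f n u \<omega> \<le> 0) \<longleftrightarrow>
      (\<forall>j::nat. \<exists>q\<in>Q. \<forall>n\<in>{..j}. f n q \<omega> < 1 / real (Suc j))" for \<omega>
  proof
    assume "\<exists>u\<in>K. \<forall>n. f n u \<omega> \<le> 0"
    then obtain u where u: "u \<in> K" "\<And>n. f n u \<omega> \<le> 0" by blast
    then obtain q where q: "\<And>i. q i \<in> Q" "q \<longlonglongrightarrow> u"
      using Q(3) closure_sequential[of u Q] by blast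
    have qK: "q i \<in> K" for i using q(1) Q(2) by blast
    show "\<forall>j::nat. \<exists>q\<in>Q. \<forall>n\<in>{..j}. f n q \<omega> < 1 / real (Suc j)"
    proof
      fix j :: nat
      have "\<forall>\<^sub>F i in sequentially. f n (q i) \<omega> < 1 / real (Suc j)" for n
      proof (rule order_tendstoD(2))
        show "(\<lambda>i. f n (q i) \<omega>) \<longlonglongrightarrow> f n u \<omega>"
          by (rule continuous_on_tendsto_compose[OF cont q(2) u(1)]) (use qK in auto)
        have "0 < 1 / real (Suc j)" by simp
        with u(2)[of n] show "f n u \<omega> < 1 / real (Suc j)" by linarith
      qed
      then have "\<forall>\<^sub>F i in sequentially. \<forall>n\<in>{..j}. f n (q i) \<omega> < 1 / real (Suc j)"
        by (intro eventually_ball_finite) auto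
      then obtain i where "\<forall>n\<in>{..j}. f n (q i) \<omega> < 1 / real (Suc j)"
        using eventually_happens'[OF sequentially_bot] by blast
      then show "\<exists>q\<in>Q. \<forall>n\<in>{..j}. f n q \<omega> < 1 / real (Suc j)" using q(1) by blast
    qed
  next
    assume "\<forall>j::nat. \<exists>q\<in>Q. \<forall>n\<in>{..j}. f n q \<omega> < 1 / real (Suc j)"
    then obtain q where q: "\<And>j. q j \<in> Q" "\<And>j n. n \<le> j \<Longrightarrow> f n (q j) \<omega> < 1 / real (Suc j)"
      by (metis atMost_iff)
    then have qK: "q j \<in> K" for j using Q(2) by blast
    then obtain u r where u: "u \<in> K" and r: "strict_mono (r :: nat \<Rightarrow> nat)"
        and lim: "(q \<circ> r) \<longlonglongrightarrow> u"
      using K unfolding compact_def by metis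
    have "f n u \<omega> \<le> 0" for n
    proof (rule LIMSEQ_le)
      show "(\<lambda>i. f n ((q \<circ> r) i) \<omega>) \<longlonglongrightarrow> f n u \<omega>"
        by (rule continuous_on_tendsto_compose[OF cont lim u]) (use qK in auto)
      show "(\<lambda>i. 1 / real (Suc i)) \<longlonglongrightarrow> 0"
        using LIMSEQ_inverse_real_of_nat by (simp add: inverse_eq_divide)
      have "f n ((q \<circ> r) i) \<omega> \<le> 1 / real (Suc i)" if "n \<le> i" for i
      proof -
        have "i \<le> r i" by (rule seq_suble[OF r])
        then have "f n (q (r i)) \<omega> < 1 / real (Suc (r i))" using that by (intro q(2)) simp
        also have "\<dots> \<le> 1 / real (Suc i)" using \<open>i \<le> r i\<close> by (intro divide_left_mono) auto
        finally show ?thesis by simp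
      qed
      then show "\<exists>N. \<forall>i\<ge>N. f n ((q \<circ> r) i) \<omega> \<le> 1 / real (Suc i)" by blast
    qed
    then show "\<exists>u\<in>K. \<forall>n. f n u \<omega> \<le> 0" using u by blast
  qed
  moreover have "Measurable.pred M (\<lambda>\<omega>. \<forall>j::nat. \<exists>q\<in>Q. \<forall>n\<in>{..j}. f n q \<omega> < 1 / real (Suc j))"
    using Q(1) by measurable
  ultimately show ?thesis by simp
qed

lemma pred_barrier_cone_hits:
  fixes K :: "'b::euclidean_space set"
  assumes "compact K"
  shows "Measurable.pred (\<Pi>\<^sub>M n\<in>(UNIV::nat set). borel) (\<lambda>s. barrier_cone s \<inter> K \<noteq> {})"
proof -
  let ?P = "\<Pi>\<^sub>M n\<in>(UNIV::nat set). borel :: 'b measure"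
  have "Measurable.pred ?P (\<lambda>s. \<exists>u\<in>K. \<forall>n. s n \<bullet> u - real N \<le> 0)" for N
    using assms by (rule pred_bex_compact_all_le_0) (auto intro!: continuous_intros)
  then have "Measurable.pred ?P (\<lambda>s. \<exists>N::nat. \<exists>u\<in>K. \<forall>n. s n \<bullet> u - real N \<le> 0)"
    by measurable
  moreover have "barrier_cone s \<inter> K \<noteq> {} \<longleftrightarrow> (\<exists>N::nat. \<exists>u\<in>K. \<forall>n. s n \<bullet> u - real N \<le> 0)"
    for s :: "nat \<Rightarrow> 'b"
    unfolding barrier_cone_def by auto
  ultimately show ?thesis by simp
qed

text \<open>
  The right-hand side involves countably many conditions on single positions, which makes the event
  on the left measurable. Compactness of \<open>K\<close> turns the nearest points of
  \<open>K\<close> into a limit direction in \<open>K\<close>.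
\<close>

lemma asymptotic_directions_hits_iff:
  fixes K :: "'b::euclidean_space set"
  assumes K: "compact K" "K \<noteq> {}"
  shows "asymptotic_directions s \<inter> K \<noteq> {} \<longleftrightarrow>
    (\<forall>m::nat. \<exists>n. real m < norm (s n) \<and> infdist (sgn (s n)) K < 1 / real (Suc m))"
proof
  assume "asymptotic_directions s \<inter> K \<noteq> {}"
  then obtain u where u: "u \<in> asymptotic_directions s" "u \<in> K" by blast
  show "\<forall>m::nat. \<exists>n. real m < norm (s n) \<and> infdist (sgn (s n)) K < 1 / real (Suc m)"
  proof
    fix m :: nat
    obtain n where "real m < norm (s n)" "norm (sgn (s n) - u) < 1 / real (Suc m)"
      using asymptotic_directionsE[OF u(1), of "1 / real (Suc m)" "real m"] by auto
    moreover have "infdist (sgn (s n)) K \<le> norm (sgn (s n) - u)"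
      using infdist_le[OF u(2), of "sgn (s n)"] by (simp add: dist_norm)
    ultimately show "\<exists>n. real m < norm (s n) \<and> infdist (sgn (s n)) K < 1 / real (Suc m)"
      by (intro exI[of _ n]) simp
  qed
next
  assume "\<forall>m::nat. \<exists>n. real m < norm (s n) \<and> infdist (sgn (s n)) K < 1 / real (Suc m)"
  then obtain f where f: "\<And>m. real m < norm (s (f m))"
      "\<And>m. infdist (sgn (s (f m))) K < 1 / real (Suc m)"
    by metis
  have "\<exists>k\<in>K. norm (sgn (s (f m)) - k) < 1 / real (Suc m)" for m
    using infdist_attains_inf[OF compact_imp_closed[OF K(1)] K(2), of "sgn (s (f m))"] f(2)[of m]
    by (metis dist_norm)
  then obtain k where k: "\<And>m. k m \<in> K" "\<And>m. norm (sgn (s (f m)) - k m) < 1 / real (Suc m)"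
    by metis
  obtain u r where u: "u \<in> K" and r: "strict_mono (r :: nat \<Rightarrow> nat)" and lim: "(k \<circ> r) \<longlonglongrightarrow> u"
    using K(1) k(1) unfolding compact_def by metis
  have "u \<in> asymptotic_directions s"
    unfolding asymptotic_directions_def
  proof (intro CollectI allI impI)
    fix e R :: real assume e: "e > 0"
    have "\<forall>\<^sub>F i in sequentially. dist ((k \<circ> r) i) u < e / 2"
      using lim half_gt_zero[OF e] by (rule tendstoD)
    moreover have "\<forall>\<^sub>F i in sequentially. 1 / real (Suc i) < e / 2"
      using order_tendstoD(2)[OF LIMSEQ_inverse_real_of_nat half_gt_zero[OF e]]
      by (simp add: inverse_eq_divide)
    moreover have "\<forall>\<^sub>F i in sequentially. R \<le> real i"
      using eventually_ge_at_top[of "nat \<lceil>R\<rceil>"] by eventually_elim linarith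
    ultimately have "\<forall>\<^sub>F i in sequentially. R < norm (s (f (r i))) \<and> norm (sgn (s (f (r i))) - u) < e"
    proof eventually_elim
      case (elim i)
      have i: "i \<le> r i" by (rule seq_suble[OF r])
      then have "R < norm (s (f (r i)))" using elim(3) f(1)[of "r i"] by linarith
      moreover have "1 / real (Suc (r i)) \<le> 1 / real (Suc i)"
        using i by (intro divide_left_mono) auto
      moreover have "norm (sgn (s (f (r i))) - u) \<le> norm (sgn (s (f (r i))) - k (r i)) + norm (k (r i) - u)"
        using norm_triangle_ineq[of "sgn (s (f (r i))) - k (r i)" "k (r i) - u"] by simp
      ultimately show ?case
        using elim(1,2) k(2)[of "r i"] by (simp add: dist_norm)
    qed
    then show "\<exists>n. R < norm (s n) \<and> norm (sgn (s n) - u) < e"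
      using eventually_happens'[OF sequentially_bot] by blast
  qed
  with u show "asymptotic_directions s \<inter> K \<noteq> {}" by blast
qed

lemma pred_asymptotic_directions_hits:
  fixes K :: "'b::euclidean_space set"
  assumes "compact K"
  shows "Measurable.pred (\<Pi>\<^sub>M n\<in>(UNIV::nat set). borel) (\<lambda>s. asymptotic_directions s \<inter> K \<noteq> {})"
proof (cases "K = {}")
  case False
  have [measurable]: "(\<lambda>x. infdist x K) \<in> borel_measurable borel"
    by (intro borel_measurable_continuous_onI continuous_intros)
  show ?thesis
    unfolding asymptotic_directions_hits_iff[OF assms False] by measurable
qed simp

lemma (in prob_space) AE_closure_barrier_cone_const:
  fixes Y :: "nat \<Rightarrow> 'a \<Rightarrow> 'b::euclidean_space"
  assumes "indep_vars (\<lambda>_. borel) Y UNIV"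
  obtains F where "AE \<omega> in M. closure (barrier_cone (\<lambda>n. \<Sum>i<n. Y i \<omega>)) = F"
proof (rule AE_closure_random_set_const[where R = "\<lambda>\<omega>. barrier_cone (\<lambda>n. \<Sum>i<n. Y i \<omega>)"])
  fix K :: "'b set" assume "compact K"
  then show "(AE \<omega> in M. barrier_cone (\<lambda>n. \<Sum>i<n. Y i \<omega>) \<inter> K \<noteq> {}) \<or>
      (AE \<omega> in M. barrier_cone (\<lambda>n. \<Sum>i<n. Y i \<omega>) \<inter> K = {})"
    using AE_or_AE_not_if_path_invariant[OF assms pred_barrier_cone_hits[of K]]
    by (simp add: barrier_cone_shift)
qed (rule that)

lemma (in prob_space) AE_asymptotic_directions_const:
  fixes Y :: "nat \<Rightarrow> 'a \<Rightarrow> 'b::euclidean_space"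
  assumes "indep_vars (\<lambda>_. borel) Y UNIV"
  obtains F where "AE \<omega> in M. asymptotic_directions (\<lambda>n. \<Sum>i<n. Y i \<omega>) = F"
proof (rule AE_closure_random_set_const[where R = "\<lambda>\<omega>. asymptotic_directions (\<lambda>n. \<Sum>i<n. Y i \<omega>)"])
  fix K :: "'b set" assume "compact K"
  then show "(AE \<omega> in M. asymptotic_directions (\<lambda>n. \<Sum>i<n. Y i \<omega>) \<inter> K \<noteq> {}) \<or>
      (AE \<omega> in M. asymptotic_directions (\<lambda>n. \<Sum>i<n. Y i \<omega>) \<inter> K = {})"
    using AE_or_AE_not_if_path_invariant[OF assms pred_asymptotic_directions_hits[of K]]
    by (simp add: asymptotic_directions_shift)
qed (simp add: closure_closed closed_asymptotic_directions that)

lemma (in prob_space) AE_mem_barrier_cone_zero_one: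
  fixes Y :: "nat \<Rightarrow> 'a \<Rightarrow> 'b::euclidean_space"
  assumes "indep_vars (\<lambda>_. borel) Y UNIV"
  shows "(AE \<omega> in M. u \<in> barrier_cone (\<lambda>n. \<Sum>i<n. Y i \<omega>)) \<or>
      (AE \<omega> in M. u \<notin> barrier_cone (\<lambda>n. \<Sum>i<n. Y i \<omega>))"
  using AE_or_AE_not_if_path_invariant[OF assms pred_barrier_cone_hits[of "{u}"]]
  by (simp add: barrier_cone_shift)

text \<open>
  The passage from each direction separately to all directions at once. The exceptional null set
  depends on \<open>u\<close>, so it must be excluded that a random direction lies in the barrier
  cone although no fixed one does. The closure of the cone is a deterministic set \<open>F\<close>.
  Convex sets with the same closure have the same relative interior, so every point of the relative
  interior of \<open>F\<close> is a fixed direction that belongs to the cone almost surely. By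
  assumption only \<open>0\<close> is possible, and the cone is contained in the closure of its
  relative interior.
\<close>

lemma (in prob_space) AE_barrier_cone_trivial:
  fixes Y :: "nat \<Rightarrow> 'a \<Rightarrow> 'b::euclidean_space"
  assumes indep: "indep_vars (\<lambda>_. borel) Y UNIV"
    and avoid: "\<And>u. u \<noteq> 0 \<Longrightarrow> AE \<omega> in M. u \<notin> barrier_cone (\<lambda>n. \<Sum>i<n. Y i \<omega>)"
  shows "AE \<omega> in M. barrier_cone (\<lambda>n. \<Sum>i<n. Y i \<omega>) \<subseteq> {0}"
proof -
  let ?C = "\<lambda>\<omega>. barrier_cone (\<lambda>n. \<Sum>i<n. Y i \<omega>)"
  obtain F where F: "AE \<omega> in M. closure (?C \<omega>) = F"
    by (rule AE_closure_barrier_cone_const[OF indep])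
  have relint: "AE \<omega> in M. rel_interior (?C \<omega>) = rel_interior F"
    using F by eventually_elim (metis convex_barrier_cone convex_rel_interior_closure)
  have "rel_interior F \<subseteq> {0}"
  proof
    fix u assume u: "u \<in> rel_interior F"
    show "u \<in> {0}"
    proof (rule ccontr)
      assume "u \<notin> {0}"
      then have "AE \<omega> in M. u \<notin> ?C \<omega>" using avoid by simp
      then have "AE \<omega> in M. False"
        using relint by eventually_elim (metis u rel_interior_subset subsetD)
      then show False by simp
    qed
  qed
  then have "closure (rel_interior F) \<subseteq> {0}" by (intro closure_minimal) auto
  then have "?C \<omega> \<subseteq> {0}" if "rel_interior (?C \<omega>) = rel_interior F" for \<omega>
    using convex_closure_rel_interior[OF convex_barrier_cone] closure_subset that
    by (metis order_trans)
  then show ?thesis by (rule eventually_mono[OF relint])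
qed

section \<open>Oscillation of a one-dimensional walk\<close>

text \<open>
  The real part of the characteristic function is the mean of a cosine, and a random variable
  bounded by \<open>1\<close> with mean \<open>1\<close> is constant.
\<close>

lemma (in prob_space) AE_cos_eq_1_if_char_eq_1:
  fixes U :: "'a \<Rightarrow> real"
  assumes [measurable]: "U \<in> borel_measurable M"
    and "char (distr M borel U) t = 1"
  shows "AE \<omega> in M. cos (t * U \<omega>) = 1"
proof -
  have int: "integrable M (\<lambda>\<omega>. iexp (t * U \<omega>))"
    by (rule integrable_iexp) auto
  have "1 = (CLINT \<omega>|M. iexp (t * U \<omega>))"
    using assms(2) unfolding char_def by (subst (asm) integral_distr) auto
  then have "1 = Re (CLINT \<omega>|M. iexp (t * U \<omega>))" by (metis one_complex.sel(1))
  also have "\<dots> = (\<integral>\<omega>. Re (iexp (t * U \<omega>)) \<partial>M)" using int by simp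
  also have "\<dots> = (\<integral>\<omega>. cos (t * U \<omega>) \<partial>M)" by (simp add: Re_exp)
  finally have "(\<integral>\<omega>. cos (t * U \<omega>) \<partial>M) = 1" by simp
  moreover have cos_int: "integrable M (\<lambda>\<omega>. cos (t * U \<omega>))"
    by (rule integrable_const_bound[of _ 1]) auto
  ultimately have "(\<integral>\<omega>. 1 - cos (t * U \<omega>) \<partial>M) = 0" by (simp add: prob_space)
  then have "AE \<omega> in M. 1 - cos (t * U \<omega>) = 0"
    using cos_int by (subst (asm) integral_nonneg_eq_0_iff_AE) auto
  then show ?thesis by simp
qed

text \<open>
  The characteristic function of \<open>V\<close> equals its own product with that of
  \<open>U\<close>. It does not vanish near \<open>0\<close>, so the characteristic function of
  \<open>U\<close> is \<open>1\<close> there. Hence \<open>t * U\<close> is almost surely a multiple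
  of \<open>2 * pi\<close> for arbitrarily small \<open>t > 0\<close>.
\<close>

lemma (in prob_space) AE_eq_0_if_indep_sum_same_law:
  fixes U V :: "'a \<Rightarrow> real"
  assumes indep: "indep_var borel U borel V"
    and law: "distr M borel (\<lambda>\<omega>. U \<omega> + V \<omega>) = distr M borel V"
  shows "AE \<omega> in M. U \<omega> = 0"
proof -
  have [measurable]: "U \<in> borel_measurable M" "V \<in> borel_measurable M"
    using indep by (auto dest: indep_var_rv1 indep_var_rv2)
  interpret V: real_distribution "distr M borel V" by (rule real_distribution_distr) simp
  have "char (distr M borel V) 0 \<noteq> 0" by (simp add: V.char_zero)
  then obtain \<delta> where \<delta>: "\<delta> > 0" "\<And>t. \<bar>t\<bar> < \<delta> \<Longrightarrow> char (distr M borel V) t \<noteq> 0"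
    using continuous_at_avoid[OF V.isCont_char[of 0], of 0] by (auto simp: dist_real_def)
  have "char (distr M borel U) t = 1" if "\<bar>t\<bar> < \<delta>" for t
    using char_distr_add[OF indep, of t] \<delta>(2)[OF that] unfolding law by simp
  moreover have "\<bar>\<delta> / real (k + 2)\<bar> < \<delta>" for k :: nat
    using mult_strict_left_mono[of 1 "real (k + 2)" \<delta>] \<delta>(1) by (simp add: divide_less_eq)
  ultimately have "AE \<omega> in M. cos (\<delta> / real (k + 2) * U \<omega>) = 1" for k :: nat
    by (intro AE_cos_eq_1_if_char_eq_1) auto
  then have "AE \<omega> in M. \<forall>k::nat. cos (\<delta> / real (k + 2) * U \<omega>) = 1"
    by (simp add: AE_all_countable)
  then show ?thesis
  proof eventually_elim
    case (elim \<omega>)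
    \<comment> \<open>An argument of modulus less than \<open>1\<close> is a multiple of \<open>2 * pi\<close> only if it is \<open>0\<close>.\<close>
    obtain k :: nat where k: "\<delta> * \<bar>U \<omega>\<bar> < real k"
      using reals_Archimedean2 by blast
    obtain n :: int where n: "\<delta> / real (k + 2) * U \<omega> = of_int n * 2 * pi"
      using elim[rule_format, of k] unfolding cos_one_2pi_int by blast
    have "\<bar>\<delta> / real (k + 2) * U \<omega>\<bar> < 1"
      using k \<delta>(1) by (simp add: abs_mult field_simps)
    then have "\<bar>of_int n\<bar> * (2 * pi) < 1" unfolding n by (simp add: abs_mult)
    then have "n = 0"
    proof -
      assume a: "\<bar>of_int n\<bar> * (2 * pi) < 1"
      show "n = 0"
      proof (rule ccontr)
        assume "n \<noteq> 0"
        then have "1 \<le> \<bar>real_of_int n\<bar>" by linarith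
        then have "1 * (2 * pi) \<le> \<bar>real_of_int n\<bar> * (2 * pi)"
          by (intro mult_right_mono) auto
        with a pi_gt3 show False by simp
      qed
    qed
    with n \<delta>(1) show "U \<omega> = 0" by simp
  qed
qed

lemma (in prob_space) distr_shifted_sequence:
  fixes Y :: "nat \<Rightarrow> 'a \<Rightarrow> real"
  assumes indep: "indep_vars (\<lambda>_. borel) Y UNIV"
    and law: "\<And>i. distr M borel (Y i) = D"
  shows "distr M (\<Pi>\<^sub>M i\<in>UNIV. borel) (\<lambda>\<omega> i. Y (Suc i) \<omega>) = distr M (\<Pi>\<^sub>M i\<in>UNIV. borel) (\<lambda>\<omega> i. Y i \<omega>)"
proof -
  have Y: "Y i \<in> borel_measurable M" for i
    using indep unfolding indep_vars_def2 by blast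
  have shifted: "indep_vars (\<lambda>_. borel) (\<lambda>j. Y (Suc j)) UNIV"
    by (rule indep_vars_reindex_inj[OF indep]) auto
  show ?thesis
    using indep_vars_iff_distr_eq_PiM'[of UNIV Y "\<lambda>_. borel"] indep
      indep_vars_iff_distr_eq_PiM'[of UNIV "\<lambda>j. Y (Suc j)" "\<lambda>_. borel"] shifted Y law
    by (simp add: restrict_UNIV)
qed

text \<open>
  A finite upper limit \<open>L\<close> of the walk satisfies \<open>L = Y 0 + L'\<close>, where
  \<open>L'\<close> is the upper limit of the walk with increments \<open>Y 1, Y 2, \<dots>\<close>.
  This \<open>L'\<close> is independent of \<open>Y 0\<close> and has the law of \<open>L\<close>,
  which forces \<open>Y 0\<close> to vanish.
\<close>

lemma (in prob_space) AE_step_eq_0_if_limsup_finite: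
  fixes Y :: "nat \<Rightarrow> 'a \<Rightarrow> real"
  assumes indep: "indep_vars (\<lambda>_. borel) Y UNIV"
    and law: "\<And>i. distr M borel (Y i) = D"
    and fin: "AE \<omega> in M. \<bar>limsup (\<lambda>n. ereal (\<Sum>i<n. Y i \<omega>))\<bar> \<noteq> \<infinity>"
  shows "AE \<omega> in M. Y 0 \<omega> = 0"
proof (rule AE_eq_0_if_indep_sum_same_law)
  let ?P = "\<Pi>\<^sub>M i\<in>(UNIV::nat set). borel :: real measure"
  define L :: "(nat \<Rightarrow> real) \<Rightarrow> real" where "L y = real_of_ereal (limsup (\<lambda>n. ereal (\<Sum>i<n. y i)))" for y
  have L[measurable]: "L \<in> borel_measurable ?P" unfolding L_def by measurable
  have Y[measurable]: "Y i \<in> borel_measurable M" for i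
    using indep unfolding indep_vars_def2 by blast
  have paths[measurable]: "(\<lambda>\<omega> i. Y i \<omega>) \<in> measurable M ?P" "(\<lambda>\<omega> i. Y (Suc i) \<omega>) \<in> measurable M ?P"
    by (rule measurable_PiM_single'; simp)+
  note [measurable] = measurable_compose[OF paths(1) L] measurable_compose[OF paths(2) L]
  show "indep_var borel (Y 0) borel (\<lambda>\<omega>. L (\<lambda>i. Y (Suc i) \<omega>))"
  proof -
    have "indep_var borel ((\<lambda>g. g 0) \<circ> (\<lambda>\<omega>. restrict (\<lambda>i. Y i \<omega>) {0}))
        borel ((\<lambda>g. L (\<lambda>i. g (Suc i))) \<circ> (\<lambda>\<omega>. restrict (\<lambda>i. Y i \<omega>) {1..}))"
    proof (rule indep_var_compose[OF indep_var_restrict[OF indep]])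
      show "(\<lambda>g. L (\<lambda>i. g (Suc i))) \<in> borel_measurable (\<Pi>\<^sub>M i\<in>{1..}. borel)"
        by (rule measurable_compose[OF _ L], rule measurable_PiM_single') auto
    qed auto
    then show ?thesis by (simp add: comp_def)
  qed
  have "AE \<omega> in M. L (\<lambda>i. Y i \<omega>) = Y 0 \<omega> + L (\<lambda>i. Y (Suc i) \<omega>)"
    using fin
  proof eventually_elim
    case (elim \<omega>)
    have "limsup (\<lambda>n. ereal (\<Sum>i<n. Y i \<omega>)) = limsup (\<lambda>n. ereal (\<Sum>i<n + 1. Y i \<omega>))"
      by (rule limsup_shift[symmetric])
    also have "\<dots> = limsup (\<lambda>n. ereal (Y 0 \<omega>) + ereal (\<Sum>i<n. Y (Suc i) \<omega>))"
      by (simp add: sum.lessThan_Suc_shift del: sum.lessThan_Suc)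
    also have "\<dots> = ereal (Y 0 \<omega>) + limsup (\<lambda>n. ereal (\<Sum>i<n. Y (Suc i) \<omega>))"
      by (rule Limsup_add_ereal_left) auto
    finally have eq: "limsup (\<lambda>n. ereal (\<Sum>i<n. Y i \<omega>)) =
        ereal (Y 0 \<omega>) + limsup (\<lambda>n. ereal (\<Sum>i<n. Y (Suc i) \<omega>))" .
    with elim show ?case
      unfolding L_def by (cases "limsup (\<lambda>n. ereal (\<Sum>i<n. Y (Suc i) \<omega>))") auto
  qed
  then have "distr M borel (\<lambda>\<omega>. Y 0 \<omega> + L (\<lambda>i. Y (Suc i) \<omega>)) = distr M borel (\<lambda>\<omega>. L (\<lambda>i. Y i \<omega>))"
    by (intro distr_cong_AE) (auto elim: eventually_mono)
  also have "\<dots> = distr (distr M ?P (\<lambda>\<omega> i. Y i \<omega>)) borel L"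
    by (subst distr_distr) (auto simp: comp_def)
  also have "\<dots> = distr (distr M ?P (\<lambda>\<omega> i. Y (Suc i) \<omega>)) borel L"
    unfolding distr_shifted_sequence[OF indep law] ..
  also have "\<dots> = distr M borel (\<lambda>\<omega>. L (\<lambda>i. Y (Suc i) \<omega>))"
    by (subst distr_distr) (auto simp: comp_def)
  finally show "distr M borel (\<lambda>\<omega>. Y 0 \<omega> + L (\<lambda>i. Y (Suc i) \<omega>)) =
      distr M borel (\<lambda>\<omega>. L (\<lambda>i. Y (Suc i) \<omega>))" .
qed

text \<open>
  Used in contraposition: a walk whose increments are not supported in a hyperplane has
  nondegenerate projections.
\<close>

lemma rv_support_subset_hyperplane:
  assumes [measurable]: "Z \<in> borel_measurable M"
    and "AE \<omega> in M. Z \<omega> \<bullet> u = 0"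
  shows "rv_support M Z \<subseteq> {x. u \<bullet> x = 0}"
proof
  fix x assume x: "x \<in> rv_support M Z"
  let ?U = "- {x. u \<bullet> x = 0}"
  have op: "open ?U" by (intro open_Compl closed_hyperplane)
  have "measure (distr M borel Z) ?U = measure M (Z -` ?U \<inter> space M)"
    using op by (intro measure_distr) auto
  also have "\<dots> = 0"
  proof -
    have "AE \<omega> in M. \<omega> \<notin> Z -` ?U \<inter> space M"
      using assms(2) by eventually_elim (simp add: inner_commute)
    moreover have "Z -` ?U \<inter> space M \<in> sets M"
      using op by (intro measurable_sets[OF assms(1)]) auto
    ultimately show ?thesis
      by (simp add: AE_iff_null_sets measure_eq_0_null_sets)
  qed
  finally show "x \<in> {x. u \<bullet> x = 0}"
    using x op unfolding rv_support_def by force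
qed

text \<open>
  By the zero-one law, otherwise the projection of the walk on \<open>u\<close> is bounded above
  almost surely. But the walk is infinitely often nearly parallel to \<open>v\<close>, so its
  projection on \<open>u\<close> is infinitely often positive and its upper limit is finite. This is
  impossible for a nondegenerate one-dimensional walk.
\<close>

lemma (in prob_space) AE_not_mem_barrier_cone_if_limit_direction:
  fixes Y :: "nat \<Rightarrow> 'a \<Rightarrow> 'b::euclidean_space"
  assumes indep: "indep_vars (\<lambda>_. borel) Y UNIV"
    and law: "\<And>i. distr M borel (Y i) = D"
    and nondeg: "\<not> (AE \<omega> in M. Y 0 \<omega> \<bullet> u = 0)"
    and v: "0 < v \<bullet> u" "AE \<omega> in M. liminf (\<lambda>n. ereal (norm (sgn (\<Sum>i<n. Y i \<omega>) - v))) = 0"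
  shows "AE \<omega> in M. u \<notin> barrier_cone (\<lambda>n. \<Sum>i<n. Y i \<omega>)"
proof (rule ccontr)
  assume "\<not> ?thesis"
  then have bdd: "AE \<omega> in M. u \<in> barrier_cone (\<lambda>n. \<Sum>i<n. Y i \<omega>)"
    using AE_mem_barrier_cone_zero_one[OF indep, of u] by blast
  have Y[measurable]: "Y i \<in> borel_measurable M" for i
    using indep unfolding indep_vars_def2 by blast
  have "AE \<omega> in M. Y 0 \<omega> \<bullet> u = 0"
  proof (rule AE_step_eq_0_if_limsup_finite[where Y = "\<lambda>i \<omega>. Y i \<omega> \<bullet> u"])
    show "indep_vars (\<lambda>_. borel) (\<lambda>i \<omega>. Y i \<omega> \<bullet> u) UNIV"
      by (rule indep_vars_compose2[OF indep]) simp
    show "distr M borel (\<lambda>\<omega>. Y i \<omega> \<bullet> u) = distr D borel (\<lambda>x. x \<bullet> u)" for i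
      unfolding law[of i, symmetric] by (subst distr_distr) (auto simp: comp_def)
    show "AE \<omega> in M. \<bar>limsup (\<lambda>n. ereal (\<Sum>i<n. Y i \<omega> \<bullet> u))\<bar> \<noteq> \<infinity>"
      using bdd v(2)
    proof eventually_elim
      case (elim \<omega>)
      let ?s = "\<lambda>n. \<Sum>i<n. Y i \<omega>"
      have "limsup (\<lambda>n. ereal (?s n \<bullet> u)) \<noteq> \<infinity>"
        using elim(1) by (simp add: limsup_inner_eq_infinity_iff[of ?s u])
      moreover have "0 \<le> limsup (\<lambda>n. ereal (?s n \<bullet> u))"
      proof (rule ccontr)
        assume "\<not> 0 \<le> limsup (\<lambda>n. ereal (?s n \<bullet> u))"
        then have "\<forall>\<^sub>F n in sequentially. ereal (?s n \<bullet> u) < 0"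
          by (intro Limsup_lessD) simp
        moreover have "\<exists>\<^sub>F n in sequentially. norm (sgn (?s n) - v) < (v \<bullet> u) / (norm u + 1)"
          using elim(2) v(1) norm_ge_zero[of u] unfolding liminf_sgn_eq_0_iff
          by (metis add_nonneg_pos divide_pos_pos zero_less_one)
        ultimately have "\<exists>\<^sub>F n in sequentially. norm (sgn (?s n) - v) < (v \<bullet> u) / (norm u + 1) \<and> ereal (?s n \<bullet> u) < 0"
          by (intro frequently_eventually_frequently)
        then obtain n where n: "norm (sgn (?s n) - v) < (v \<bullet> u) / (norm u + 1)" "?s n \<bullet> u < 0"
          by (auto dest!: frequently_ex)
        have "(v - sgn (?s n)) \<bullet> u \<le> norm (sgn (?s n) - v) * norm u"
          using norm_cauchy_schwarz[of "v - sgn (?s n)" u] by (simp add: norm_minus_commute)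
        \<comment> \<open>The summand \<open>1\<close> in the tolerance keeps its denominator positive.\<close>
        also have "\<dots> \<le> norm (sgn (?s n) - v) * (norm u + 1)"
          by (intro mult_left_mono) auto
        also have "\<dots> < v \<bullet> u"
          using n(1) by (simp add: pos_less_divide_eq add_nonneg_pos)
        finally have "0 < sgn (?s n) \<bullet> u" by (simp add: inner_diff_left)
        then show False using n(2) by (simp add: sgn_div_norm zero_less_mult_iff)
      qed
      ultimately have "\<bar>limsup (\<lambda>n. ereal (?s n \<bullet> u))\<bar> \<noteq> \<infinity>" by auto
      then show ?case by (simp add: inner_sum_left)
    qed
  qed
  with nondeg show False by blast
qed

section \<open>Filling space and oscillating in every direction\<close>

theorem theorem9p2:
  fixes M :: "'w measure"
    and Z :: "'w \<Rightarrow> real ^ 'd"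
    and X :: "nat \<Rightarrow> 'w \<Rightarrow> real ^ 'd"
  assumes "prob_space M"
    and "Z \<in> borel_measurable M"
    and "prob_space.indep_vars M (\<lambda>_. borel) X {1..}"
    and "\<And>k. k \<ge> 1 \<Longrightarrow> distr M borel (X k) = distr M borel Z"
    and "\<not> (\<exists>V. subspace V \<and> dim V = CARD('d) - 1 \<and> rv_support M Z \<subseteq> V)"
  shows "(0 \<in> interior (convex hull (limit_directions M X))
            \<longrightarrow> (AE \<omega> in M. hull_inradius_inf X \<omega> = \<infinity>))
       \<and> ((AE \<omega> in M. hull_inradius_inf X \<omega> = \<infinity>)
            \<longleftrightarrow> (AE \<omega> in M. walk_hull_inf X \<omega> = UNIV))
       \<and> ((AE \<omega> in M. walk_hull_inf X \<omega> = UNIV)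
            \<longleftrightarrow> oscillation_directions M X = sphere 0 1)
       \<and> (oscillation_directions M X = sphere 0 1
            \<longrightarrow> 0 \<in> convex hull (limit_directions M X))"
proof -
  interpret prob_space M by fact
  \<comment> \<open>The walk sums the increments from index \<open>1\<close> on.\<close>
  define Y where "Y i = X (Suc i)" for i
  have walk: "walk X n \<omega> = (\<Sum>i<n. Y i \<omega>)" for n \<omega>
    unfolding walk_def Y_def by (simp add: sum.atLeast1_atMost_eq)
  have law: "distr M borel (Y i) = distr M borel Z" for i
    unfolding Y_def by (rule assms(4)) simp
  have indep: "indep_vars (\<lambda>_. borel) Y UNIV"
    unfolding Y_def by (rule indep_vars_reindex_inj[OF assms(3)]) auto
  let ?osc = "\<forall>u. u \<noteq> 0 \<longrightarrow> (AE \<omega> in M. u \<notin> barrier_cone (\<lambda>n. walk X n \<omega>))"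
  have hull: "walk_hull_inf X \<omega> = UNIV \<longleftrightarrow> barrier_cone (\<lambda>n. walk X n \<omega>) \<subseteq> {0}" for \<omega>
    unfolding walk_hull_inf_eq_convex_hull by (rule convex_hull_range_eq_UNIV_iff)
  have hull_osc: "(AE \<omega> in M. walk_hull_inf X \<omega> = UNIV) \<longleftrightarrow> ?osc"
  proof
    assume "AE \<omega> in M. walk_hull_inf X \<omega> = UNIV"
    then show ?osc unfolding hull by (auto elim: eventually_mono)
  next
    assume ?osc
    then show "AE \<omega> in M. walk_hull_inf X \<omega> = UNIV"
      unfolding hull walk by (intro AE_barrier_cone_trivial[OF indep]) auto
  qed
  have i_osc: ?osc if int: "0 \<in> interior (convex hull (limit_directions M X))"
  proof (intro allI impI)
    fix u :: "real ^ 'd" assume u: "u \<noteq> 0"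
    \<comment> \<open>Otherwise the hull lies in a half-space with \<open>0\<close> on its boundary.\<close>
    have "\<exists>v\<in>limit_directions M X. 0 < v \<bullet> u"
    proof (rule ccontr)
      assume "\<not> ?thesis"
      then have "convex hull (limit_directions M X) \<subseteq> {x. u \<bullet> x \<le> 0}"
        by (intro hull_minimal convex_halfspace_le) (auto simp: inner_commute not_less)
      then have "0 \<in> interior {x. u \<bullet> x \<le> 0}"
        using int interior_mono by blast
      then show False using u by (simp add: interior_halfspace_le)
    qed
    then obtain v where v: "v \<in> limit_directions M X" "0 < v \<bullet> u" by blast
    have "\<not> (AE \<omega> in M. Y 0 \<omega> \<bullet> u = 0)"
    proof
      assume "AE \<omega> in M. Y 0 \<omega> \<bullet> u = 0"
      moreover have "Y 0 \<in> borel_measurable M"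
        using indep unfolding indep_vars_def2 by blast
      ultimately have "rv_support M (Y 0) \<subseteq> {x. u \<bullet> x = 0}"
        by (intro rv_support_subset_hyperplane)
      then have "rv_support M Z \<subseteq> {x. u \<bullet> x = 0}"
        unfolding rv_support_def law .
      moreover have "subspace {x. u \<bullet> x = 0}" by (rule subspace_hyperplane)
      moreover have "dim {x. u \<bullet> x = 0} = CARD('d) - 1"
        using dim_hyperplane[OF u] by simp
      ultimately show False using assms(5) by blast
    qed
    with v show "AE \<omega> in M. u \<notin> barrier_cone (\<lambda>n. walk X n \<omega>)"
      unfolding walk limit_directions_def
      by (intro AE_not_mem_barrier_cone_if_limit_direction[OF indep law, of u v]) auto
  qed
  \<comment> \<open>The asymptotic directions form a fixed compact set of limit directions. If its hull missed \<open>0\<close>, it would lie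
    strictly on one side of a hyperplane, and the walk could not be unbounded on the other side.\<close>
  have osc_v: "0 \<in> convex hull (limit_directions M X)" if osc: ?osc
  proof -
    obtain F where F: "AE \<omega> in M. asymptotic_directions (\<lambda>n. walk X n \<omega>) = F"
      unfolding walk by (rule AE_asymptotic_directions_const[OF indep])
    obtain \<omega>0 where \<omega>0: "asymptotic_directions (\<lambda>n. walk X n \<omega>0) = F"
      using eventually_happens'[OF _ F] by (auto simp: ae_filter_eq_bot_iff emeasure_space_1)
    have F_sphere: "F \<subseteq> sphere 0 1"
      unfolding \<omega>0[symmetric] by (rule asymptotic_directions_subset_sphere)
    have "closed F" unfolding \<omega>0[symmetric] by (rule closed_asymptotic_directions)
    then have "compact F"
      using F_sphere bounded_subset[OF bounded_sphere] by (metis compact_eq_bounded_closed)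
    have F_dir: "F \<subseteq> limit_directions M X"
    proof
      fix u assume u: "u \<in> F"
      have "AE \<omega> in M. liminf (\<lambda>n. ereal (norm (sgn (walk X n \<omega>) - u))) = 0"
        using F by eventually_elim (use u liminf_sgn_eq_0_if_asymptotic_direction in blast)
      then show "u \<in> limit_directions M X"
        unfolding limit_directions_def using u F_sphere by auto
    qed
    have "0 \<in> convex hull F"
    proof (rule ccontr)
      assume "0 \<notin> convex hull F"
      \<comment> \<open>Compactness of \<open>F\<close> is needed here: mere separation would only give \<open>0 \<le> a \<bullet> x\<close>.\<close>
      then obtain a b where a: "a \<noteq> 0" "0 < b" and sep: "\<forall>x\<in>convex hull F. b < a \<bullet> x"
        using separating_hyperplane_closed_0[OF convex_convex_hull
            compact_imp_closed[OF compact_convex_hull[OF \<open>compact F\<close>]]] by blast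
      have "AE \<omega> in M. - a \<notin> barrier_cone (\<lambda>n. walk X n \<omega>)" using osc a(1) by simp
      then have "AE \<omega> in M. False"
        using F
      proof eventually_elim
        case (elim \<omega>)
        obtain w where w: "w \<in> F" "0 \<le> w \<bullet> - a"
          using asymptotic_direction_in_halfspace[OF elim(1)] elim(2) by blast
        then have "b < a \<bullet> w" using sep by (simp add: hull_inc)
        with w(2) a(2) show False by (simp add: inner_commute)
      qed
      then show False by simp
    qed
    then show ?thesis using hull_mono[OF F_dir] by blast
  qed
  show ?thesis
    unfolding hull_inradius_inf_eq_infinity_iff hull_osc oscillation_directions_eq_sphere_iff
    using i_osc osc_v by blast
qed

end
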